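(* Let $n,k$ be positive integers and let $X$ be a set with $nk$ elements partitioned into $k$ subsets $X_1,X_2,\ldots,X_k$ of size $n$. Let $S_n$ act on $X$ by acting via every possible permutation on each subset simultaneously: that is, writing $X_i=\{x_{i,1},\ldots,x_{i,n}\}$, each $\sigma\in S_n$ sends $x_{i,j}$ to $x_{i,\sigma(j)}$ for all $1\le i\le k$ and $1\le j\le n$. Then $D_{S_n}(X)=\lceil \sqrt[k]{n}\,\rceil$.
   Context: For a group $\Gamma$ acting faithfully on a finite set $X$, an $r$-distinguishing labeling is a function $\phi:X\to\{1,\ldots,r\}$ such that the only $g\in\Gamma$ with $\phi(gx)=\phi(x)$ for all $x\in X$ is the identity. The distinguishing number $D_\Gamma(X)$ is the smallest $r$ for which an $r$-distinguishing labeling exists. *)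

theory Defs
  imports
    Complex_Main
    "HOL-Library.Disjoint_Sets"
    "HOL-Algebra.Group_Action"
    "HOL-Algebra.Sym_Groups"
begin

definition distinguishing_labeling ::
    "('g, 'm) monoid_scheme \<Rightarrow> 'a set \<Rightarrow> ('g \<Rightarrow> 'a \<Rightarrow> 'a) \<Rightarrow> nat \<Rightarrow> ('a \<Rightarrow> nat) \<Rightarrow> bool"
  where "distinguishing_labeling G X act r f \<longleftrightarrow>
    f \<in> X \<rightarrow> {1..r} \<and>
    (\<forall>g\<in>carrier G. (\<forall>x\<in>X. f (act g x) = f x) \<longrightarrow> g = \<one>\<^bsub>G\<^esub>)"

text \<open>The least element below exists for a faithful action on a finite set, by the lemma that
  follows. For other actions the value need not be meaningful.\<close>

definition distinguishing_number ::
    "('g, 'm) monoid_scheme \<Rightarrow> 'a set \<Rightarrow> ('g \<Rightarrow> 'a \<Rightarrow> 'a) \<Rightarrow> nat"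
  where "distinguishing_number G X act = (LEAST r. \<exists>f. distinguishing_labeling G X act r f)"

lemma distinguishing_labeling_exists:
  assumes "faithful_action G X act" and "finite X"
  shows "\<exists>r f. distinguishing_labeling G X act r f"
proof -
  interpret faithful_action G X act by fact
  obtain h where h: "bij_betw h X {1..card X}"
    using finite_same_card_bij[of X "{1..card X}"] assms(2) by auto
  have one: "\<one>\<^bsub>G\<^esub> \<in> carrier G"
    using group_hom by (simp add: group_hom_def group.is_monoid monoid.one_closed)
  have "g = \<one>\<^bsub>G\<^esub>" if g: "g \<in> carrier G" and lab: "\<forall>x\<in>X. h (act g x) = h x" for g
  proof -
    have "act g x = x" if "x \<in> X" for x
      using element_image[OF g that refl] lab that h by (auto simp: bij_betw_def inj_on_def)
    then have "act g = (\<lambda>x\<in>X. x)"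
      using bij_prop0[OF g] by (auto simp: Bij_def extensional_def)
    then have "act g = act \<one>\<^bsub>G\<^esub>" using id_eq_one by simp
    then show ?thesis using faithful g one by (auto simp: inj_on_def)
  qed
  then have "distinguishing_labeling G X act (card X) h"
    using h by (auto simp: distinguishing_labeling_def bij_betw_def)
  then show ?thesis by blast
qed

end

theory Submission
  imports Defs
begin

text \<open>A labeling assigns to each \<open>j\<close> the word of labels of \<open>x\<^sub>1\<^sub>j, \<dots>, x\<^sub>k\<^sub>j\<close>. A permutation preserves the
  labeling iff it preserves the words, so the labeling is distinguishing iff the \<open>n\<close> words of length
  \<open>k\<close> are pairwise distinct (a transposition exchanges two equal words). There are \<open>r ^ k\<close> words
  over \<open>r\<close> letters, so the distinguishing number is the least \<open>r\<close> with \<open>n \<le> r ^ k\<close>.\<close>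

lemma distinguishing_labeling_iff_inj_on:
  fixes x :: "'i \<Rightarrow> nat \<Rightarrow> 'a"
  assumes X: "X = (\<lambda>(i, j). x i j) ` (I \<times> {1..n})"
    and act: "\<And>\<sigma> i j. \<lbrakk>\<sigma> \<in> carrier (sym_group n); i \<in> I; j \<in> {1..n}\<rbrakk> \<Longrightarrow> act \<sigma> (x i j) = x i (\<sigma> j)"
  shows "distinguishing_labeling (sym_group n) X act r f \<longleftrightarrow>
    f \<in> X \<rightarrow> {1..r} \<and> inj_on (\<lambda>j. \<lambda>i\<in>I. f (x i j)) {1..n}"
proof -
  \<comment> \<open>The word of \<open>j\<close>. Restricting it to \<open>I\<close> makes equality
    of words as functions the same as agreement of labels at every index in
    \<open>I\<close>.\<close>
  define w where "w j = (\<lambda>i\<in>I. f (x i j))" for j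
  have w_eq: "w j = w j' \<longleftrightarrow> (\<forall>i\<in>I. f (x i j) = f (x i j'))" for j j'
    by (auto simp: w_def restrict_def fun_eq_iff)
  have pres: "(\<forall>y\<in>X. f (act \<sigma> y) = f y) \<longleftrightarrow> (\<forall>j\<in>{1..n}. w (\<sigma> j) = w j)"
    if "\<sigma> permutes {1..n}" for \<sigma>
  proof -
    have "f (act \<sigma> (x i j)) = f (x i (\<sigma> j))" if "i \<in> I" "j \<in> {1..n}" for i j
      using act[OF _ that] \<open>\<sigma> permutes {1..n}\<close> by (simp add: sym_group_def)
    then show ?thesis unfolding X w_eq by fastforce
  qed
  have "(\<forall>\<sigma>. \<sigma> permutes {1..n} \<longrightarrow> (\<forall>j\<in>{1..n}. w (\<sigma> j) = w j) \<longrightarrow> \<sigma> = id) \<longleftrightarrow> inj_on w {1..n}"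
    (is "?triv \<longleftrightarrow> _")
  proof
    assume triv: ?triv
    show "inj_on w {1..n}"
    proof (rule inj_onI)
      fix a b assume ab: "a \<in> {1..n}" "b \<in> {1..n}" and "w a = w b"
      then have "\<forall>j\<in>{1..n}. w (transpose a b j) = w j" by (auto simp: transpose_def)
      then have "transpose a b = id" using triv permutes_swap_id[OF ab] by blast
      then show "a = b" by (metis id_apply transpose_apply_first)
    qed
  next
    assume inj: "inj_on w {1..n}"
    show ?triv
    proof (intro allI impI)
      fix \<sigma> assume \<sigma>: "\<sigma> permutes {1..n}" and "\<forall>j\<in>{1..n}. w (\<sigma> j) = w j"
      \<comment> \<open>Both \<open>j\<close> and its image lie in \<open>{1..n}\<close>, where
        distinct elements have distinct words. Outside \<open>{1..n}\<close> a permutation of this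
        set is the identity anyway.\<close>
      then have "\<forall>j\<in>{1..n}. \<sigma> j = j" using inj permutes_in_image[OF \<sigma>] by (metis inj_onD)
      then show "\<sigma> = id" using \<sigma> by (metis eq_id_iff permutes_not_in)
    qed
  qed
  with pres show ?thesis
    unfolding distinguishing_labeling_def w_def[symmetric] by (simp add: sym_group_def cong: imp_cong)
qed

text \<open>Distinguishing labelings yield injections from \<open>{1..n}\<close> into the set of
  words. Conversely, every family of words comes from a labeling, since each point of
  \<open>X\<close> has a unique pair of indices.\<close>

lemma distinguishing_labeling_exists_iff:
  fixes x :: "'i \<Rightarrow> nat \<Rightarrow> 'a"
  assumes "finite I"
    and bij: "bij_betw (\<lambda>(i, j). x i j) (I \<times> {1..n}) X"
    and act: "\<And>\<sigma> i j. \<lbrakk>\<sigma> \<in> carrier (sym_group n); i \<in> I; j \<in> {1..n}\<rbrakk> \<Longrightarrow> act \<sigma> (x i j) = x i (\<sigma> j)"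
  shows "(\<exists>f. distinguishing_labeling (sym_group n) X act r f) \<longleftrightarrow> n \<le> r ^ card I"
proof -
  have X: "X = (\<lambda>(i, j). x i j) ` (I \<times> {1..n})" using bij by (simp add: bij_betw_def)
  \<comment> \<open>Extensional functions give each word a single representative, so that
    \<open>W\<close> is finite and can be counted.\<close>
  define W where "W = (I \<rightarrow>\<^sub>E {1..r})"
  have fin: "finite W" and card: "card W = r ^ card I"
    unfolding W_def using \<open>finite I\<close> by (auto simp: card_PiE finite_PiE)
  note iff = distinguishing_labeling_iff_inj_on[OF X act, of r]
  show ?thesis
  proof
    assume "\<exists>f. distinguishing_labeling (sym_group n) X act r f"
    then obtain f where f: "f \<in> X \<rightarrow> {1..r}" and inj: "inj_on (\<lambda>j. \<lambda>i\<in>I. f (x i j)) {1..n}"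
      using iff by blast
    have "(\<lambda>j. \<lambda>i\<in>I. f (x i j)) ` {1..n} \<subseteq> W" using f unfolding W_def X by fastforce
    from card_inj_on_le[OF inj this fin] show "n \<le> r ^ card I" by (simp add: card)
  next
    assume "n \<le> r ^ card I"
    then obtain c where c: "c ` {1..n} \<subseteq> W" "inj_on c {1..n}"
      using card_le_inj[of "{1..n}" W] fin card by auto
    \<comment> \<open>The label of a point is found by recovering its indices \<open>(i, j)\<close>
      and taking the letter at \<open>i\<close> of the word chosen for \<open>j\<close>.\<close>
    define f where "f y = (case inv_into (I \<times> {1..n}) (\<lambda>(i, j). x i j) y of (i, j) \<Rightarrow> c j i)" for y
    have f: "f (x i j) = c j i" if "i \<in> I" "j \<in> {1..n}" for i j
      using bij_betw_inv_into_left[OF bij, of "(i, j)"] that by (simp add: f_def)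
    have "(\<lambda>i\<in>I. f (x i j)) = c j" if "j \<in> {1..n}" for j
    proof -
      \<comment> \<open>Agreement on \<open>I\<close> alone does not give equal functions; both
        sides must also take the default value \<open>undefined\<close> elsewhere.\<close>
      have "c j \<in> extensional I" using c(1) that unfolding W_def by (auto simp: PiE_def)
      then show ?thesis using f that by (auto simp: extensional_def)
    qed
    then have "inj_on (\<lambda>j. \<lambda>i\<in>I. f (x i j)) {1..n}" using c(2) inj_on_cong[of "{1..n}"] by (metis (no_types, lifting))
    moreover have "f \<in> X \<rightarrow> {1..r}"
    proof
      fix y assume "y \<in> X"
      then obtain i j where "i \<in> I" "j \<in> {1..n}" "y = x i j" unfolding X by auto
      moreover from this have "c j \<in> W" using c(1) by blast
      ultimately show "f y \<in> {1..r}" using f unfolding W_def by auto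
    qed
    ultimately show "\<exists>f. distinguishing_labeling (sym_group n) X act r f" using iff by blast
  qed
qed

text \<open>Taking the root is monotone, and \<open>r\<close> is an integer, so the admissible
  \<open>r\<close> are exactly those from the ceiling of the root upwards.\<close>

lemma Least_le_power_eq_ceiling_root:
  assumes "k > 0"
  shows "int (LEAST r. n \<le> r ^ k) = \<lceil>root k (real n)\<rceil>"
proof -
  have "n \<le> r ^ k \<longleftrightarrow> nat \<lceil>root k (real n)\<rceil> \<le> r" for r
  proof -
    have "n \<le> r ^ k \<longleftrightarrow> real n \<le> real r ^ k" by (metis of_nat_le_iff of_nat_power)
    also have "\<dots> \<longleftrightarrow> root k (real n) \<le> root k (real r ^ k)" using assms by simp
    also have "root k (real r ^ k) = real r" using assms by (simp add: real_root_power_cancel)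
    also have "root k (real n) \<le> real r \<longleftrightarrow> nat \<lceil>root k (real n)\<rceil> \<le> r" by linarith
    finally show ?thesis .
  qed
  then have "(LEAST r. n \<le> r ^ k) = nat \<lceil>root k (real n)\<rceil>" by (intro Least_equality) blast+
  \<comment> \<open>Nonnegativity ensures that \<open>nat\<close> does not truncate the
    ceiling.\<close>
  moreover have "0 \<le> root k (real n)" using assms by simp
  ultimately show ?thesis by simp
qed

theorem theorem4p1:
  fixes n k :: nat
    and X :: "'a set"
    and Xs :: "nat \<Rightarrow> 'a set"
    and x :: "nat \<Rightarrow> nat \<Rightarrow> 'a"
    and act :: "(nat \<Rightarrow> nat) \<Rightarrow> 'a \<Rightarrow> 'a"
  assumes "n > 0" and "k > 0"
    and "card X = n * k"
    and "(\<Union>i\<in>{1..k}. Xs i) = X"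
    and "disjoint_family_on Xs {1..k}"
    and "\<And>i. i \<in> {1..k} \<Longrightarrow> card (Xs i) = n"
    and "\<And>i. i \<in> {1..k} \<Longrightarrow> bij_betw (x i) {1..n} (Xs i)"
    and "group_action (sym_group n) X act"
    and "\<And>\<sigma> i j. \<lbrakk>\<sigma> \<in> carrier (sym_group n); i \<in> {1..k}; j \<in> {1..n}\<rbrakk>
           \<Longrightarrow> act \<sigma> (x i j) = x i (\<sigma> j)"
  shows "int (distinguishing_number (sym_group n) X act) = \<lceil>root k (real n)\<rceil>"
proof -
  \<comment> \<open>Disjointness of the blocks determines \<open>i\<close>; injectivity of
    \<open>x i\<close> then determines \<open>j\<close>.\<close>
  have "inj_on (\<lambda>(i, j). x i j) ({1..k} \<times> {1..n})"
  proof (rule inj_onI, clarify)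
    fix i j i' j' assume I: "i \<in> {1..k}" "i' \<in> {1..k}" and J: "j \<in> {1..n}" "j' \<in> {1..n}"
      and eq: "x i j = x i' j'"
    have "x i j \<in> Xs i" "x i' j' \<in> Xs i'"
      using assms(7)[OF I(1)] assms(7)[OF I(2)] J by (meson bij_betwE)+
    then have "i = i'" using disjoint_family_onD[OF assms(5) I] eq by auto
    moreover from this have "j = j'"
      using inj_onD[OF bij_betw_imp_inj_on[OF assms(7)[OF I(1)]] _ J] eq by blast
    ultimately show "i = i' \<and> j = j'" ..
  qed
  moreover have "(\<lambda>(i, j). x i j) ` ({1..k} \<times> {1..n}) = X"
  proof -
    have "(\<lambda>(i, j). x i j) ` ({1..k} \<times> {1..n}) = (\<Union>i\<in>{1..k}. x i ` {1..n})" by auto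
    also have "\<dots> = X" using assms(4,7) by (simp add: bij_betw_def)
    finally show ?thesis .
  qed
  ultimately have "bij_betw (\<lambda>(i, j). x i j) ({1..k} \<times> {1..n}) X" by (simp add: bij_betw_def)
  \<comment> \<open>The equivalence holds for every \<open>r\<close>, so both least elements are
    taken over the same predicate.\<close>
  from distinguishing_labeling_exists_iff[OF _ this assms(9)]
  have "distinguishing_number (sym_group n) X act = (LEAST r. n \<le> r ^ k)"
    by (simp add: distinguishing_number_def)
  then show ?thesis using Least_le_power_eq_ceiling_root[OF \<open>k > 0\<close>] by simp
qed

end
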